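(* Every lower bounded lattice has a lattice embedding into some complete, lower continuous, join-semidistributive lattice.
   Context: A lattice homomorphism $f\colon K\to L$ is lower bounded if the preimage under $f$ of any principal filter of $L$ is either empty or has a least element. A (not necessarily finitely generated) lattice $L$ is lower bounded if every lattice homomorphism from a finitely generated free lattice to $L$ is lower bounded. A lattice $L$ is lower continuous if $a\vee\bigwedge X=\bigwedge\{a\vee x\mid x\in X\}$ for every $a\in L$ and every downward directed $X\subseteq L$ such that $\bigwedge X$ exists. A lattice is join-semidistributive if $x\vee y=x\vee z$ implies $x\vee y=x\vee(y\wedge z)$. *)

theory Defs
  imports "HOL-Algebra.Complete_Lattice"
begin

section \<open>Free lattices\<close>

text \<open>
  The free lattice over a set \<open>X\<close> of generators is the algebra of lattice terms over \<open>X\<close>,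
  modulo provable equality. Inequality of terms is generated by the axioms saying that it is a
  preorder in which joins and meets are least upper and greatest lower bounds.
\<close>

datatype (gens: 'x) lterm =
  Gen 'x
| Join "'x lterm" "'x lterm"
| Meet "'x lterm" "'x lterm"

inductive lterm_le :: "'x lterm \<Rightarrow> 'x lterm \<Rightarrow> bool" (infix "\<preceq>" 50) where
  refl: "s \<preceq> s"
| trans: "r \<preceq> s \<Longrightarrow> s \<preceq> t \<Longrightarrow> r \<preceq> t"
| join_left: "s \<preceq> Join s t"
| join_right: "t \<preceq> Join s t"
| join_least: "r \<preceq> t \<Longrightarrow> s \<preceq> t \<Longrightarrow> Join r s \<preceq> t"
| meet_left: "Meet s t \<preceq> s"
| meet_right: "Meet s t \<preceq> t"
| meet_greatest: "r \<preceq> s \<Longrightarrow> r \<preceq> t \<Longrightarrow> r \<preceq> Meet s t"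

definition lterms :: "'x set \<Rightarrow> 'x lterm set"
  where "lterms X = {t. gens t \<subseteq> X}"

definition lterm_eq :: "'x set \<Rightarrow> ('x lterm \<times> 'x lterm) set"
  where "lterm_eq X = {(s, t). s \<in> lterms X \<and> t \<in> lterms X \<and> s \<preceq> t \<and> t \<preceq> s}"

definition free_lattice :: "'x set \<Rightarrow> 'x lterm set gorder"
  where "free_lattice X =
    \<lparr>carrier = lterms X // lterm_eq X, eq = (=), le = (\<lambda>A B. \<forall>s\<in>A. \<forall>t\<in>B. s \<preceq> t)\<rparr>"


section \<open>Homomorphisms and lower bounded lattices\<close>

definition lattice_homs :: "('a, 'c) gorder_scheme \<Rightarrow> ('b, 'd) gorder_scheme \<Rightarrow> ('a \<Rightarrow> 'b) set"
  where "lattice_homs K L = {f \<in> carrier K \<rightarrow> carrier L. join_pres K L f \<and> meet_pres K L f}"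

definition lattice_embeddings ::
    "('a, 'c) gorder_scheme \<Rightarrow> ('b, 'd) gorder_scheme \<Rightarrow> ('a \<Rightarrow> 'b) set"
  where "lattice_embeddings K L = {f \<in> lattice_homs K L. inj_on f (carrier K)}"

definition principal_filter :: "('a, 'c) gorder_scheme \<Rightarrow> 'a \<Rightarrow> 'a set"
  where "principal_filter L a = {x \<in> carrier L. a \<sqsubseteq>\<^bsub>L\<^esub> x}"

definition lower_bounded_hom ::
    "('a, 'c) gorder_scheme \<Rightarrow> ('b, 'd) gorder_scheme \<Rightarrow> ('a \<Rightarrow> 'b) \<Rightarrow> bool"
  where "lower_bounded_hom K L f \<longleftrightarrow> f \<in> lattice_homs K L \<and>
    (\<forall>a\<in>carrier L. let P = {x \<in> carrier K. f x \<in> principal_filter L a}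
                   in P = {} \<or> (\<exists>m. least K m P))"

text \<open>
  Up to isomorphism, the finitely generated free lattices are the free lattices over the
  sets \<open>{..<n}\<close>.
\<close>

definition lower_bounded_lattice :: "('a, 'c) gorder_scheme \<Rightarrow> bool"
  where "lower_bounded_lattice L \<longleftrightarrow> lattice L \<and>
    (\<forall>n::nat. \<forall>f\<in>lattice_homs (free_lattice {..<n}) L.
       lower_bounded_hom (free_lattice {..<n}) L f)"


section \<open>Lower continuity and join-semidistributivity\<close>

definition downward_directed :: "('a, 'c) gorder_scheme \<Rightarrow> 'a set \<Rightarrow> bool"
  where "downward_directed L X \<longleftrightarrow> X \<noteq> {} \<and> X \<subseteq> carrier L \<and>
    (\<forall>x\<in>X. \<forall>y\<in>X. \<exists>z\<in>X. z \<sqsubseteq>\<^bsub>L\<^esub> x \<and> z \<sqsubseteq>\<^bsub>L\<^esub> y)"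

text \<open>
  Meets are expressed by \<^const>\<open>is_glb\<close>, since the total function \<^const>\<open>Lattice.inf\<close> returns an
  arbitrary value where no meet exists. In particular, the meet on the right-hand side of the
  identity is part of the claim.
\<close>

definition lower_continuous :: "('a, 'c) gorder_scheme \<Rightarrow> bool"
  where "lower_continuous L \<longleftrightarrow> lattice L \<and>
    (\<forall>a\<in>carrier L. \<forall>X m. downward_directed L X \<longrightarrow> is_glb L m X \<longrightarrow>
       is_glb L (a \<squnion>\<^bsub>L\<^esub> m) ((\<lambda>x. a \<squnion>\<^bsub>L\<^esub> x) ` X))"

definition join_semidistributive :: "('a, 'c) gorder_scheme \<Rightarrow> bool"
  where "join_semidistributive L \<longleftrightarrow> lattice L \<and>
    (\<forall>x\<in>carrier L. \<forall>y\<in>carrier L. \<forall>z\<in>carrier L.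
       x \<squnion>\<^bsub>L\<^esub> y = x \<squnion>\<^bsub>L\<^esub> z \<longrightarrow> x \<squnion>\<^bsub>L\<^esub> y = x \<squnion>\<^bsub>L\<^esub> (y \<sqinter>\<^bsub>L\<^esub> z))"


section \<open>The universal property of free lattices\<close>

definition lclass :: "'x set \<Rightarrow> 'x lterm \<Rightarrow> 'x lterm set"
  where "lclass X t = lterm_eq X `` {t}"

lemma lterms_simps [simp]:
  "Gen x \<in> lterms X \<longleftrightarrow> x \<in> X"
  "Join s t \<in> lterms X \<longleftrightarrow> s \<in> lterms X \<and> t \<in> lterms X"
  "Meet s t \<in> lterms X \<longleftrightarrow> s \<in> lterms X \<and> t \<in> lterms X"
  by (auto simp: lterms_def)

lemma carrier_free_lattice: "carrier (free_lattice X) = lclass X ` lterms X"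
  by (auto simp: free_lattice_def lclass_def quotient_def)

lemma lclass_in_carrier [simp]: "t \<in> lterms X \<Longrightarrow> lclass X t \<in> carrier (free_lattice X)"
  by (simp add: carrier_free_lattice)

lemma mem_lclass: "s \<in> lclass X t \<longleftrightarrow> s \<in> lterms X \<and> t \<in> lterms X \<and> s \<preceq> t \<and> t \<preceq> s"
  by (auto simp: lclass_def lterm_eq_def)

lemma le_lclass:
  assumes "s \<in> lterms X" "t \<in> lterms X"
  shows "lclass X s \<sqsubseteq>\<^bsub>free_lattice X\<^esub> lclass X t \<longleftrightarrow> s \<preceq> t"
proof
  assume "lclass X s \<sqsubseteq>\<^bsub>free_lattice X\<^esub> lclass X t"
  thus "s \<preceq> t"
    using assms by (simp add: free_lattice_def mem_lclass lterm_le.refl)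
next
  assume st: "s \<preceq> t"
  have "u \<preceq> v" if "u \<preceq> s" "t \<preceq> v" for u v
    by (rule lterm_le.trans[OF that(1) lterm_le.trans[OF st that(2)]])
  thus "lclass X s \<sqsubseteq>\<^bsub>free_lattice X\<^esub> lclass X t"
    by (simp add: free_lattice_def mem_lclass)
qed

lemma lclass_eq:
  assumes "s \<in> lterms X" "t \<in> lterms X"
  shows "lclass X s = lclass X t \<longleftrightarrow> s \<preceq> t \<and> t \<preceq> s"
proof
  assume "lclass X s = lclass X t"
  moreover have "s \<in> lclass X s"
    using assms by (simp add: mem_lclass lterm_le.refl)
  ultimately show "s \<preceq> t \<and> t \<preceq> s"
    by (simp add: mem_lclass)
next
  assume st: "s \<preceq> t \<and> t \<preceq> s"
  have "u \<preceq> s \<longleftrightarrow> u \<preceq> t" "s \<preceq> u \<longleftrightarrow> t \<preceq> u" for u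
    using st lterm_le.trans[of u s t] lterm_le.trans[of u t s]
      lterm_le.trans[of s t u] lterm_le.trans[of t s u] by iprover+
  thus "lclass X s = lclass X t"
    using assms by (auto simp: mem_lclass)
qed

lemma eq_free_lattice [simp]: "(.=\<^bsub>free_lattice X\<^esub>) = (=)"
  by (simp add: free_lattice_def)

lemma partial_order_free_lattice: "partial_order (free_lattice X)"
proof unfold_locales
  fix A B C
  assume "A \<in> carrier (free_lattice X)" "B \<in> carrier (free_lattice X)"
    "C \<in> carrier (free_lattice X)" "A \<sqsubseteq>\<^bsub>free_lattice X\<^esub> B" "B \<sqsubseteq>\<^bsub>free_lattice X\<^esub> C"
  thus "A \<sqsubseteq>\<^bsub>free_lattice X\<^esub> C"
    by (auto simp: carrier_free_lattice le_lclass intro: lterm_le.trans)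
next
  fix A B
  assume "A \<in> carrier (free_lattice X)" "B \<in> carrier (free_lattice X)"
    "A \<sqsubseteq>\<^bsub>free_lattice X\<^esub> B" "B \<sqsubseteq>\<^bsub>free_lattice X\<^esub> A"
  thus "A .=\<^bsub>free_lattice X\<^esub> B"
    unfolding eq_free_lattice carrier_free_lattice
    by (elim imageE) (simp add: le_lclass lclass_eq)
next
  fix A
  assume "A \<in> carrier (free_lattice X)"
  thus "A \<sqsubseteq>\<^bsub>free_lattice X\<^esub> A"
    by (auto simp: carrier_free_lattice le_lclass intro: lterm_le.refl)
qed simp_all

lemma is_lub_free_lattice:
  assumes "s \<in> lterms X" "t \<in> lterms X"
  shows "is_lub (free_lattice X) (lclass X (Join s t)) {lclass X s, lclass X t}"
  unfolding least_def
proof (intro conjI ballI)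
  show "lclass X (Join s t) \<in> Upper (free_lattice X) {lclass X s, lclass X t}"
    using assms by (auto simp: Upper_def le_lclass lterm_le.join_left lterm_le.join_right)
next
  fix A
  assume A: "A \<in> Upper (free_lattice X) {lclass X s, lclass X t}"
  then obtain u where u: "u \<in> lterms X" "A = lclass X u"
    by (auto simp: Upper_def carrier_free_lattice)
  with A assms have "s \<preceq> u" "t \<preceq> u"
    by (simp_all add: Upper_def le_lclass)
  hence "Join s t \<preceq> u"
    by (rule lterm_le.join_least)
  with u assms show "lclass X (Join s t) \<sqsubseteq>\<^bsub>free_lattice X\<^esub> A"
    by (simp add: le_lclass)
qed (simp add: Upper_def)

lemma is_glb_free_lattice:
  assumes "s \<in> lterms X" "t \<in> lterms X"
  shows "is_glb (free_lattice X) (lclass X (Meet s t)) {lclass X s, lclass X t}"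
  unfolding greatest_def
proof (intro conjI ballI)
  show "lclass X (Meet s t) \<in> Lower (free_lattice X) {lclass X s, lclass X t}"
    using assms by (auto simp: Lower_def le_lclass lterm_le.meet_left lterm_le.meet_right)
next
  fix A
  assume A: "A \<in> Lower (free_lattice X) {lclass X s, lclass X t}"
  then obtain u where u: "u \<in> lterms X" "A = lclass X u"
    by (auto simp: Lower_def carrier_free_lattice)
  with A assms have "u \<preceq> s" "u \<preceq> t"
    by (simp_all add: Lower_def le_lclass)
  hence "u \<preceq> Meet s t"
    by (rule lterm_le.meet_greatest)
  with u assms show "A \<sqsubseteq>\<^bsub>free_lattice X\<^esub> lclass X (Meet s t)"
    by (simp add: le_lclass)
qed (simp add: Lower_def)

theorem lattice_free_lattice: "lattice (free_lattice X)"
proof -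
  interpret partial_order "free_lattice X" by (rule partial_order_free_lattice)
  show ?thesis
    by standard (auto simp: carrier_free_lattice intro: is_lub_free_lattice is_glb_free_lattice)
qed

lemma join_free_lattice:
  assumes "s \<in> lterms X" "t \<in> lterms X"
  shows "lclass X s \<squnion>\<^bsub>free_lattice X\<^esub> lclass X t = lclass X (Join s t)"
proof -
  interpret lattice "free_lattice X" by (rule lattice_free_lattice)
  have "is_lub (free_lattice X) (lclass X s \<squnion>\<^bsub>free_lattice X\<^esub> lclass X t)
          {lclass X s, lclass X t}"
    unfolding join_def sup_def by (rule someI[where x = "lclass X (Join s t)"])
      (rule is_lub_free_lattice[OF assms])
  thus ?thesis using is_lub_free_lattice[OF assms] least_unique by blast
qed

lemma meet_free_lattice:
  assumes "s \<in> lterms X" "t \<in> lterms X"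
  shows "lclass X s \<sqinter>\<^bsub>free_lattice X\<^esub> lclass X t = lclass X (Meet s t)"
proof -
  interpret lattice "free_lattice X" by (rule lattice_free_lattice)
  have "is_glb (free_lattice X) (lclass X s \<sqinter>\<^bsub>free_lattice X\<^esub> lclass X t)
          {lclass X s, lclass X t}"
    unfolding meet_def inf_def by (rule someI[where x = "lclass X (Meet s t)"])
      (rule is_glb_free_lattice[OF assms])
  thus ?thesis using is_glb_free_lattice[OF assms] greatest_unique by blast
qed

primrec leval :: "('a, 'c) gorder_scheme \<Rightarrow> ('x \<Rightarrow> 'a) \<Rightarrow> 'x lterm \<Rightarrow> 'a" where
  "leval L g (Gen x) = g x"
| "leval L g (Join s t) = leval L g s \<squnion>\<^bsub>L\<^esub> leval L g t"
| "leval L g (Meet s t) = leval L g s \<sqinter>\<^bsub>L\<^esub> leval L g t"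

lemma leval_closed:
  assumes "lattice L" "g \<in> X \<rightarrow> carrier L" "t \<in> lterms X"
  shows "leval L g t \<in> carrier L"
proof -
  interpret lattice L by fact
  show ?thesis using assms(2,3) by (induction t) auto
qed

text \<open>
  The derivation of an inequality may pass through terms with generators outside \<open>X\<close>; this is
  harmless, because an assignment of the generators in \<open>X\<close> extends to all generators.
\<close>

lemma leval_mono:
  assumes "lattice L" "range g \<subseteq> carrier L" "s \<preceq> t"
  shows "leval L g s \<sqsubseteq>\<^bsub>L\<^esub> leval L g t"
proof -
  interpret lattice L by fact
  have cl: "leval L g t \<in> carrier L" for t
    using leval_closed[OF assms(1), of g UNIV t] assms(2) by (auto simp: lterms_def)
  show ?thesis
    using assms(3)
  proof induction
    case (trans r s t)
    show ?case by (rule le_trans[OF trans.IH cl cl cl])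
  next
    case (join_least r t s)
    show ?case using join_le[OF join_least.IH cl cl cl] by simp
  next
    case (meet_greatest r s t)
    show ?case using meet_le[OF meet_greatest.IH cl cl cl] by simp
  qed (simp_all add: cl join_left join_right meet_left meet_right)
qed

lemma leval_cong: "(\<And>x. x \<in> gens t \<Longrightarrow> g x = h x) \<Longrightarrow> leval L g t = leval L h t"
  by (induction t) auto

lemma leval_mono_on:
  assumes "lattice L" "g \<in> X \<rightarrow> carrier L" "s \<in> lterms X" "t \<in> lterms X" "s \<preceq> t"
  shows "leval L g s \<sqsubseteq>\<^bsub>L\<^esub> leval L g t"
proof -
  define h where "h x = (if x \<in> X then g x else leval L g s)" for x
  have "range h \<subseteq> carrier L"
    using assms(2) leval_closed[OF assms(1-3)] by (auto simp: h_def)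
  moreover have "leval L g s = leval L h s" "leval L g t = leval L h t"
    using assms(3,4) by (auto intro!: leval_cong simp: h_def lterms_def)
  ultimately show ?thesis
    using leval_mono[OF assms(1) _ assms(5), of h] by simp
qed

theorem free_lattice_universal:
  assumes "lattice L" "g \<in> X \<rightarrow> carrier L"
  shows "\<exists>f\<in>lattice_homs (free_lattice X) L. \<forall>x\<in>X. f (lclass X (Gen x)) = g x"
proof -
  interpret lattice L by fact
  define f where "f A = leval L g (SOME t. t \<in> A)" for A
  have f: "f (lclass X t) = leval L g t" if t: "t \<in> lterms X" for t
  proof -
    have "t \<in> lclass X t" using t by (simp add: mem_lclass lterm_le.refl)
    hence "(SOME s. s \<in> lclass X t) \<in> lclass X t" by (rule someI)
    thus ?thesis unfolding f_def
      using leval_mono_on[OF assms] leval_closed[OF assms] t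
      by (auto simp: mem_lclass intro!: le_antisym)
  qed
  have "f \<in> lattice_homs (free_lattice X) L"
    using assms lattice_free_lattice leval_closed[OF assms]
    by (auto simp: lattice_homs_def join_pres_def meet_pres_def carrier_free_lattice f
        join_free_lattice meet_free_lattice)
  moreover have "\<forall>x\<in>X. f (lclass X (Gen x)) = g x"
    by (simp add: f)
  ultimately show ?thesis by blast
qed

theorem free_lattice_hom_unique:
  assumes "f \<in> lattice_homs (free_lattice X) L" "h \<in> lattice_homs (free_lattice X) L"
    and "\<And>x. x \<in> X \<Longrightarrow> f (lclass X (Gen x)) = h (lclass X (Gen x))"
    and "A \<in> carrier (free_lattice X)"
  shows "f A = h A"
proof -
  have "f (lclass X t) = h (lclass X t)" if "t \<in> lterms X" for t
    using that
  proof (induction t)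
    case (Gen x)
    thus ?case using assms(3) by simp
  next
    case (Join s t)
    thus ?case using assms(1,2)
      by (simp add: lattice_homs_def join_pres_def flip: join_free_lattice)
  next
    case (Meet s t)
    thus ?case using assms(1,2)
      by (simp add: lattice_homs_def meet_pres_def flip: meet_free_lattice)
  qed
  thus ?thesis using assms(4) by (auto simp: carrier_free_lattice)
qed

end

theory Submission
  imports Defs
begin

text \<open>
  The target lattice consists of the filters \<open>F\<close> of \<open>L\<close>, ordered by reverse inclusion, that are
  closed under stable limits: if the values in \<open>L\<close> of a decreasing sequence of terms in finitely
  many generators lie in \<open>F\<close>, then so does the value of its meet in the free lattice. Stable limits are
  compatible with joins and meets with elements of \<open>L\<close>, because free lattices are lower continuous
  for such sequences by Whitman's condition; this makes the lattice of closed filters lower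
  continuous. Since \<open>L\<close> is lower bounded, principal filters are closed.

  For join-semidistributivity, put \<open>y\<^sub>0 = y\<close>, \<open>z\<^sub>0 = z\<close>,
  \<open>y\<^bsub>n+1\<^esub> = y \<sqinter> (w \<squnion> z\<^sub>n)\<close>, \<open>z\<^bsub>n+1\<^esub> = z \<sqinter> (w \<squnion> y\<^sub>n)\<close>. By Whitman's condition
  \<open>w \<squnion> (y \<sqinter> z)\<close> is the meet of the \<open>w \<squnion> y\<^sub>n\<close> in the free lattice. If the joins of a closed
  filter \<open>F\<close> with closed filters \<open>G\<close> and \<open>H\<close> agree, that is, \<open>F \<inter> G = F \<inter> H\<close>, then for \<open>w \<in> F\<close>,
  \<open>y \<in> G\<close>, \<open>z \<in> H\<close> every \<open>w \<squnion> y\<^sub>n\<close> lies in \<open>F \<inter> G\<close>, hence so does \<open>w \<squnion> (y \<sqinter> z)\<close>.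
\<close>

section \<open>Limits of decreasing sequences in free lattices\<close>

lemma le_joinI1: "r \<preceq> s \<Longrightarrow> r \<preceq> Join s t"
  using lterm_le.trans lterm_le.join_left by blast

lemma le_joinI2: "r \<preceq> t \<Longrightarrow> r \<preceq> Join s t"
  using lterm_le.trans lterm_le.join_right by blast

lemma meet_leI1: "s \<preceq> r \<Longrightarrow> Meet s t \<preceq> r"
  using lterm_le.trans lterm_le.meet_left by blast

lemma meet_leI2: "t \<preceq> r \<Longrightarrow> Meet s t \<preceq> r"
  using lterm_le.trans lterm_le.meet_right by blast

lemma join_leD: "Join r s \<preceq> t \<Longrightarrow> r \<preceq> t" "Join r s \<preceq> t \<Longrightarrow> s \<preceq> t"
  using lterm_le.trans lterm_le.join_left lterm_le.join_right by blast+

lemma le_meetD: "r \<preceq> Meet s t \<Longrightarrow> r \<preceq> s" "r \<preceq> Meet s t \<Longrightarrow> r \<preceq> t"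
  using lterm_le.trans lterm_le.meet_left lterm_le.meet_right by blast+

lemmas lterm_leI = lterm_le.refl le_joinI1 le_joinI2 lterm_le.join_least
  meet_leI1 meet_leI2 lterm_le.meet_greatest

lemma join_mono: "s \<preceq> t \<Longrightarrow> Join r s \<preceq> Join r t"
  by (blast intro: lterm_leI)

lemma meet_mono: "s \<preceq> t \<Longrightarrow> Meet r s \<preceq> Meet r t"
  by (blast intro: lterm_leI)

text \<open>
  Double the interval from \<open>m\<close> to \<open>j\<close> of the free lattice and lift every generator to the upper
  copy. The predicate says that the resulting value of a term is above the upper copy of \<open>m\<close>.
\<close>

primrec above :: "'x lterm \<Rightarrow> 'x lterm \<Rightarrow> 'x lterm \<Rightarrow> bool" where
  "above m j (Gen x) \<longleftrightarrow> m \<preceq> Gen x"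
| "above m j (Join s t) \<longleftrightarrow>
    above m j s \<or> above m j t \<or> m \<preceq> Join s t \<and> \<not> Join s t \<preceq> j"
| "above m j (Meet s t) \<longleftrightarrow> above m j s \<and> above m j t"

lemma above_imp_le: "above m j t \<Longrightarrow> m \<preceq> t"
  by (induction t) (auto intro: lterm_leI)

text \<open>Outside the interval from \<open>m\<close> to \<open>j\<close> nothing is doubled. Only
  meets need an argument: both factors again lie above \<open>m\<close> and not below
  \<open>j\<close>.\<close>

lemma above_outside: "m \<preceq> t \<Longrightarrow> \<not> t \<preceq> j \<Longrightarrow> above m j t"
proof (induction t)
  case (Meet s t)
  have "m \<preceq> s" "m \<preceq> t"
    using Meet.prems(1) by (auto dest: le_meetD)
  moreover have "\<not> s \<preceq> j" "\<not> t \<preceq> j"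
    using Meet.prems(2) meet_leI1 meet_leI2 by blast+
  ultimately show ?case using Meet.IH by simp
qed auto

text \<open>Evaluation in the doubled lattice respects the order. The critical rule is
  \<open>join_least\<close>: if \<open>Join r s\<close> is not below \<open>j\<close>, neither is
  \<open>t\<close>, so \<open>above_outside\<close> applies.\<close>

lemma above_mono: "s \<preceq> t \<Longrightarrow> above m j s \<Longrightarrow> above m j t"
proof (induction rule: lterm_le.induct)
  case (join_least r t s)
  have "Join r s \<preceq> t" using join_least.hyps by (rule lterm_le.join_least)
  hence "above m j t" if "m \<preceq> Join r s" "\<not> Join r s \<preceq> j"
    using that join_least.hyps by (meson above_outside le_joinI1 lterm_le.trans lterm_le.refl)
  thus ?case using join_least by auto
qed auto

text \<open>Take \<open>m = Gen x\<close> and \<open>j = Join c d\<close>. The last alternative for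
  a join is void because \<open>Join c d\<close> is below \<open>j\<close>, so \<open>above\<close>
  passes to \<open>c\<close> or \<open>d\<close>.\<close>

lemma whitman_gen:
  assumes "Gen x \<preceq> Join c d"
  shows "Gen x \<preceq> c \<or> Gen x \<preceq> d"
proof -
  have "above (Gen x) (Join c d) (Join c d)"
    by (rule above_mono[OF assms]) (simp add: lterm_le.refl)
  thus ?thesis using above_imp_le by (auto simp: lterm_le.refl)
qed

text \<open>Double the interval from \<open>Meet a b\<close> to \<open>Join c d\<close>. If
  \<open>a\<close> and \<open>b\<close> are both outside it, then \<open>above\<close> holds for
  \<open>Meet a b\<close>, by monotonicity for \<open>Join c d\<close>, and hence for
  \<open>c\<close> or \<open>d\<close>.\<close>

lemma whitman_meet:
  assumes "Meet a b \<preceq> Join c d"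
  shows "a \<preceq> Join c d \<or> b \<preceq> Join c d \<or> Meet a b \<preceq> c \<or> Meet a b \<preceq> d"
proof (rule ccontr)
  assume neg: "\<not> ?thesis"
  have "above (Meet a b) (Join c d) (Meet a b)"
    using neg by (simp add: above_outside lterm_le.meet_left lterm_le.meet_right)
  hence "above (Meet a b) (Join c d) (Join c d)" by (rule above_mono[OF assms])
  thus False using neg above_imp_le by (auto simp: lterm_le.refl)
qed

text \<open>
  The term \<open>u\<close> need not be a lower bound of the sequence. Nothing is lost, since it lies above all
  lower bounds and filters are upward closed.
\<close>

definition below_limit :: "(nat \<Rightarrow> 'x lterm) \<Rightarrow> 'x lterm \<Rightarrow> bool"
  where "below_limit t u \<longleftrightarrow>
    (\<forall>n. t (Suc n) \<preceq> t n) \<and> (\<forall>b. (\<forall>n. b \<preceq> t n) \<longrightarrow> b \<preceq> u)"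

lemma lterm_chain_antimono:
  assumes "\<And>n. t (Suc n) \<preceq> t n" "m \<le> n"
  shows "t n \<preceq> t m"
  using assms(2)
  by (induction rule: dec_induct) (auto intro: assms(1) lterm_le.refl lterm_le.trans)

text \<open>Whitman's condition offers alternatives at each index, and the choice may vary with
  \<open>n\<close>. Since the sequence decreases, an alternative that fails once fails from then on,
  so one of them holds throughout.\<close>

lemma le_join_chainE:
  assumes dec: "\<And>n. t (Suc n) \<preceq> t n"
    and le: "\<And>n. b \<preceq> Join x (t n)"
    and irr: "\<And>c d. b \<noteq> Join c d"
  obtains "b \<preceq> x" | "\<And>n. b \<preceq> t n"
  | c d where "b = Meet c d" "\<And>n. c \<preceq> Join x (t n)"
  | c d where "b = Meet c d" "\<And>n. d \<preceq> Join x (t n)"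
proof (cases b)
  case (Gen i)
  thus thesis using whitman_gen le that by metis
next
  case (Join c d)
  with irr show thesis by blast
next
  case (Meet c d)
  note antimono = lterm_chain_antimono[of t, OF dec]
  have *: "b \<preceq> t n" if neg: "\<not> b \<preceq> x" "\<not> c \<preceq> Join x (t k)" "\<not> d \<preceq> Join x (t l)" for n k l
  proof -
    define i where "i = max n (max k l)"
    have "Join x (t i) \<preceq> Join x (t k)" "Join x (t i) \<preceq> Join x (t l)"
      by (auto intro!: join_mono antimono simp: i_def)
    hence "b \<preceq> t i"
      using whitman_meet[of c d x "t i"] le[of i] neg Meet by (metis lterm_le.trans)
    moreover have "t i \<preceq> t n" by (rule antimono) (simp add: i_def)
    ultimately show ?thesis by (rule lterm_le.trans)
  qed
  show thesis using * that Meet by blast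
qed

text \<open>Induction on the lower bound \<open>b\<close>: joins split, and otherwise
  \<open>le_join_chainE\<close> either settles the case or makes a factor of \<open>b\<close> a
  lower bound.\<close>

lemma below_limit_join:
  assumes "below_limit t u"
  shows "below_limit (\<lambda>n. Join x (t n)) (Join x u)"
proof -
  have dec: "t (Suc n) \<preceq> t n" for n using assms by (simp add: below_limit_def)
  have "b \<preceq> Join x u" (is "_ \<preceq> ?u") if "\<And>n. b \<preceq> Join x (t n)" for b
    using that
  proof (induction b)
    case (Gen i)
    show ?case
      by (rule le_join_chainE[of t "Gen i" x, OF dec Gen])
        (use assms in \<open>auto simp: below_limit_def intro: le_joinI1 le_joinI2\<close>)
  next
    case (Join c d)
    have "c \<preceq> ?u" "d \<preceq> ?u"
      using Join.prems by (auto intro!: Join.IH dest: join_leD)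
    thus ?case by (rule lterm_le.join_least)
  next
    case (Meet c d)
    show ?case
      by (rule le_join_chainE[of t "Meet c d" x, OF dec Meet.prems])
        (use assms Meet.IH in \<open>auto simp: below_limit_def intro: le_joinI1 le_joinI2 meet_leI1 meet_leI2\<close>)
  qed
  thus ?thesis using dec by (simp add: below_limit_def join_mono)
qed

lemma below_limit_meet:
  assumes "below_limit t u"
  shows "below_limit (\<lambda>n. Meet x (t n)) (Meet x u)"
  using assms unfolding below_limit_def
  by (blast intro: meet_mono lterm_le.meet_greatest dest: le_meetD)

section \<open>The alternating sequences for join-semidistributivity\<close>

text \<open>One recursion yields both sequences: exchanging the last two arguments turns
  \<open>y\<close>-terms into \<open>z\<close>-terms.\<close>

primrec sd_term :: "'x lterm \<Rightarrow> nat \<Rightarrow> 'x lterm \<Rightarrow> 'x lterm \<Rightarrow> 'x lterm" where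
  "sd_term w 0 y z = y"
| "sd_term w (Suc n) y z = Meet y (Join w (sd_term w n z y))"

lemma sd_term_dec: "sd_term w (Suc n) y z \<preceq> sd_term w n y z"
  by (induction n arbitrary: y z) (auto intro: meet_mono join_mono lterm_le.meet_left)

lemma sd_term_le: "sd_term w n y z \<preceq> y"
  by (cases n) (auto intro: lterm_leI)

text \<open>Each term of one sequence is, from index 1 on, below the join of \<open>w\<close> with
  the preceding term of the other.\<close>

lemma le_join_sd_term_swap:
  assumes "\<And>n. b \<preceq> Join w (sd_term w n y z)"
  shows "b \<preceq> Join w (sd_term w n z y)"
proof -
  have "sd_term w (Suc n) y z \<preceq> Join w (sd_term w n z y)"
    by (simp add: lterm_le.meet_right)
  hence "Join w (sd_term w (Suc n) y z) \<preceq> Join w (sd_term w n z y)"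
    by (blast intro: lterm_le.join_left lterm_le.join_least)
  thus ?thesis using assms lterm_le.trans by blast
qed

text \<open>Unless \<open>b\<close> is a join, apply \<open>le_join_chainE\<close> to both
  sequences: \<open>b\<close> is below \<open>w\<close>, or below both \<open>y\<close> and
  \<open>z\<close>, or a factor of \<open>b\<close> is a lower bound for one sequence, hence for
  both, and induction applies.\<close>

lemma below_limit_sd_term: "below_limit (\<lambda>n. Join w (sd_term w n y z)) (Join w (Meet y z))"
proof -
  have "b \<preceq> Join w (Meet y z)" (is "_ \<preceq> ?u") if "\<And>n. b \<preceq> Join w (sd_term w n y z)" for b
    using that
  proof (induction b)
    case (Join c d)
    have "c \<preceq> ?u" "d \<preceq> ?u"
      using Join.prems by (auto intro!: Join.IH dest: join_leD)
    thus ?case by (rule lterm_le.join_least)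
  next
    case (Gen i)
    have le: "Gen i \<preceq> w \<or> Gen i \<preceq> x"
      if "\<And>n. Gen i \<preceq> Join w (sd_term w n x x')" for x x'
      by (rule le_join_chainE[of "\<lambda>n. sd_term w n x x'" "Gen i" w, OF sd_term_dec that])
        (use lterm_le.trans[OF _ sd_term_le] in blast)+
    show ?case
      using le[OF Gen] le[OF le_join_sd_term_swap[OF Gen]] by (blast intro: lterm_leI)
  next
    case (Meet c d)
    have le: "Meet c d \<preceq> w \<or> Meet c d \<preceq> x \<or> (\<forall>n. c \<preceq> Join w (sd_term w n x x'))
        \<or> (\<forall>n. d \<preceq> Join w (sd_term w n x x'))"
      if "\<And>n. Meet c d \<preceq> Join w (sd_term w n x x')" for x x'
      by (rule le_join_chainE[of "\<lambda>n. sd_term w n x x'" "Meet c d" w, OF sd_term_dec that])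
        (use lterm_le.trans[OF _ sd_term_le] in blast)+
    have rec: "Meet c d \<preceq> Join w (Meet y z)"
      if "(\<forall>n. c \<preceq> Join w (sd_term w n y z)) \<or> (\<forall>n. d \<preceq> Join w (sd_term w n y z))"
      using that Meet.IH by (blast intro: lterm_leI)
    show ?case
      using le[OF Meet.prems] le[OF le_join_sd_term_swap[OF Meet.prems]]
        le_join_sd_term_swap[of c w z y] le_join_sd_term_swap[of d w z y] rec
      by (blast intro: lterm_leI)
  qed
  thus ?thesis by (simp add: below_limit_def join_mono sd_term_dec del: sd_term.simps)
qed


section \<open>Limits in lower bounded lattices\<close>

text \<open>The generators are the numbers below \<open>k\<close> to match the free lattices in the
  definition of lower boundedness.\<close>

definition stable_limit :: "('a, 'c) gorder_scheme \<Rightarrow> (nat \<Rightarrow> 'a) \<Rightarrow> 'a \<Rightarrow> bool"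
  where "stable_limit L s v \<longleftrightarrow> (\<exists>(k::nat) g t u.
    g \<in> {..<k} \<rightarrow> carrier L \<and> (\<forall>n. t n \<in> lterms {..<k}) \<and> u \<in> lterms {..<k} \<and>
    below_limit t u \<and> s = (\<lambda>n. leval L g (t n)) \<and> v = leval L g u)"

lemma stable_limit_closed:
  assumes "lattice L" "stable_limit L s v"
  shows "s n \<in> carrier L" "v \<in> carrier L"
  using assms unfolding stable_limit_def by (auto intro: leval_closed)

lemma lterms_lessThan_Suc: "t \<in> lterms {..<k} \<Longrightarrow> t \<in> lterms {..<Suc k}"
  by (auto simp: lterms_def)

lemma leval_fun_upd: "t \<in> lterms {..<k} \<Longrightarrow> leval L (g(k := a)) t = leval L g t"
  for k :: nat
  by (rule leval_cong) (auto simp: lterms_def)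

text \<open>A fresh generator \<open>k\<close> with value \<open>a\<close> turns the operation with
  \<open>a\<close> into an operation on terms.\<close>

lemma stable_limit_join_meet:
  assumes "stable_limit L s v" "a \<in> carrier L"
  shows "stable_limit L (\<lambda>n. a \<squnion>\<^bsub>L\<^esub> s n) (a \<squnion>\<^bsub>L\<^esub> v)" (is ?join)
    and "stable_limit L (\<lambda>n. a \<sqinter>\<^bsub>L\<^esub> s n) (a \<sqinter>\<^bsub>L\<^esub> v)" (is ?meet)
proof -
  obtain k :: nat and g t u where t: "g \<in> {..<k} \<rightarrow> carrier L" "\<forall>n. t n \<in> lterms {..<k}"
    "u \<in> lterms {..<k}" "below_limit t u" "s = (\<lambda>n. leval L g (t n))" "v = leval L g u"
    using assms(1) unfolding stable_limit_def by blast
  have g: "g(k := a) \<in> {..<Suc k} \<rightarrow> carrier L"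
    using t(1) assms(2) by (auto simp: Pi_iff less_Suc_eq)
  show ?join unfolding stable_limit_def
    by (rule exI[of _ "Suc k"], rule exI[of _ "g(k := a)"],
        rule exI[of _ "\<lambda>n. Join (Gen k) (t n)"], rule exI[of _ "Join (Gen k) u"])
      (use g t in \<open>simp add: below_limit_join leval_fun_upd lterms_lessThan_Suc\<close>)
  show ?meet unfolding stable_limit_def
    by (rule exI[of _ "Suc k"], rule exI[of _ "g(k := a)"],
        rule exI[of _ "\<lambda>n. Meet (Gen k) (t n)"], rule exI[of _ "Meet (Gen k) u"])
      (use g t in \<open>simp add: below_limit_meet leval_fun_upd lterms_lessThan_Suc\<close>)
qed

lemma hom_lclass:
  assumes "f \<in> lattice_homs (free_lattice X) L" "\<forall>x\<in>X. f (lclass X (Gen x)) = g x"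
    and "t \<in> lterms X"
  shows "f (lclass X t) = leval L g t"
  using assms(3)
proof (induction t)
  case (Gen x)
  thus ?case using assms(2) by simp
next
  case (Join s t)
  thus ?case using assms(1)
    by (simp add: lattice_homs_def join_pres_def flip: join_free_lattice)
next
  case (Meet s t)
  thus ?case using assms(1)
    by (simp add: lattice_homs_def meet_pres_def flip: meet_free_lattice)
qed

text \<open>Lower boundedness enters here: the preimage of the filter of \<open>a\<close> contains
  all \<open>t n\<close>, so it has a least element, the class of some \<open>b\<close>. Then
  \<open>b\<close> is below every \<open>t n\<close>, hence below \<open>u\<close>, and evaluation
  gives the claim.\<close>

lemma stable_limit_greatest:
  assumes L: "lower_bounded_lattice L" and "stable_limit L s v"
    and a: "a \<in> carrier L" "\<And>n. a \<sqsubseteq>\<^bsub>L\<^esub> s n"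
  shows "a \<sqsubseteq>\<^bsub>L\<^esub> v"
proof -
  interpret lattice L using L by (simp add: lower_bounded_lattice_def)
  obtain k :: nat and g t u where g: "g \<in> {..<k} \<rightarrow> carrier L"
    and t: "\<And>n. t n \<in> lterms {..<k}" and u: "u \<in> lterms {..<k}"
    and lim: "below_limit t u" and s: "s = (\<lambda>n. leval L g (t n))" and v: "v = leval L g u"
    using assms(2) unfolding stable_limit_def by blast
  let ?F = "free_lattice {..<k}"
  obtain f where f: "f \<in> lattice_homs ?F L" "\<forall>x\<in>{..<k}. f (lclass {..<k} (Gen x)) = g x"
    using free_lattice_universal[OF lattice_axioms g] by blast
  note f_lclass = hom_lclass[OF f]
  define P where "P = {x \<in> carrier ?F. f x \<in> principal_filter L a}"
  have tP: "lclass {..<k} (t n) \<in> P" for n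
    using a(2)[of n] t[of n] leval_closed[OF lattice_axioms g t]
    by (simp add: P_def principal_filter_def f_lclass s)
  have "lower_bounded_hom ?F L f"
    using L f(1) unfolding lower_bounded_lattice_def by blast
  hence "P = {} \<or> (\<exists>m. least ?F m P)"
    using a(1) unfolding lower_bounded_hom_def P_def Let_def by blast
  then obtain m where m: "least ?F m P" using tP by blast
  hence "m \<in> P" by (simp add: least_def)
  then obtain b where b: "b \<in> lterms {..<k}" "m = lclass {..<k} b"
    by (auto simp: P_def carrier_free_lattice)
  have "b \<preceq> t n" for n
    using m tP[of n] t[of n] b by (auto simp: least_def le_lclass)
  hence "b \<preceq> u" using lim by (simp add: below_limit_def)
  hence "leval L g b \<sqsubseteq>\<^bsub>L\<^esub> leval L g u"
    by (rule leval_mono_on[OF lattice_axioms g b(1) u])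
  moreover have "a \<sqsubseteq>\<^bsub>L\<^esub> leval L g b"
    using \<open>m \<in> P\<close> b by (simp add: P_def principal_filter_def f_lclass)
  ultimately show ?thesis
    unfolding v using a(1) leval_closed[OF lattice_axioms g] b(1) u by (blast intro: le_trans)
qed

primrec sd_seq :: "('a, 'c) gorder_scheme \<Rightarrow> 'a \<Rightarrow> nat \<Rightarrow> 'a \<Rightarrow> 'a \<Rightarrow> 'a" where
  "sd_seq L w 0 y z = y"
| "sd_seq L w (Suc n) y z = y \<sqinter>\<^bsub>L\<^esub> (w \<squnion>\<^bsub>L\<^esub> sd_seq L w n z y)"

lemma leval_sd_term:
  "leval L g (sd_term w n y z) = sd_seq L (leval L g w) n (leval L g y) (leval L g z)"
  by (induction n arbitrary: y z) auto

lemma sd_term_in_lterms: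
  "w \<in> lterms X \<Longrightarrow> y \<in> lterms X \<Longrightarrow> z \<in> lterms X \<Longrightarrow> sd_term w n y z \<in> lterms X"
  by (induction n arbitrary: y z) auto

lemma stable_limit_sd_seq:
  assumes "w \<in> carrier L" "y \<in> carrier L" "z \<in> carrier L"
  shows "stable_limit L (\<lambda>n. w \<squnion>\<^bsub>L\<^esub> sd_seq L w n y z) (w \<squnion>\<^bsub>L\<^esub> (y \<sqinter>\<^bsub>L\<^esub> z))"
proof -
  \<comment> \<open>The generators 0, 1, 2 stand for \<open>w\<close>, \<open>y\<close>,
    \<open>z\<close>.\<close>
  define g where "g i = (if i = 0 then w else if i = 1 then y else z)" for i :: nat
  show ?thesis unfolding stable_limit_def
    by (rule exI[of _ 3], rule exI[of _ g],
        rule exI[of _ "\<lambda>n. Join (Gen 0) (sd_term (Gen 0) n (Gen 1) (Gen 2))"],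
        rule exI[of _ "Join (Gen 0) (Meet (Gen 1) (Gen 2))"])
      (use assms in \<open>auto simp: g_def below_limit_sd_term sd_term_in_lterms leval_sd_term\<close>)
qed


section \<open>The lattice of closed filters\<close>

text \<open>
  The empty set counts as a closed filter; it is the top of the lattice of closed filters.
\<close>

definition closed_filters :: "('a, 'c) gorder_scheme \<Rightarrow> 'a set set"
  where "closed_filters L = {F. F \<subseteq> carrier L \<and>
    (\<forall>x\<in>F. \<forall>y\<in>carrier L. x \<sqsubseteq>\<^bsub>L\<^esub> y \<longrightarrow> y \<in> F) \<and>
    (\<forall>x\<in>F. \<forall>y\<in>F. x \<sqinter>\<^bsub>L\<^esub> y \<in> F) \<and>
    (\<forall>s v. stable_limit L s v \<longrightarrow> (\<forall>n. s n \<in> F) \<longrightarrow> v \<in> F)}"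

definition closed_filter_lattice :: "('a, 'c) gorder_scheme \<Rightarrow> 'a set gorder"
  where "closed_filter_lattice L =
    \<lparr>carrier = closed_filters L, eq = (=), le = (\<lambda>F G. G \<subseteq> F)\<rparr>"

lemma closed_filter_lattice_simps [simp]:
  "carrier (closed_filter_lattice L) = closed_filters L"
  "(.=\<^bsub>closed_filter_lattice L\<^esub>) = (=)"
  "F \<sqsubseteq>\<^bsub>closed_filter_lattice L\<^esub> G \<longleftrightarrow> G \<subseteq> F"
  by (simp_all add: closed_filter_lattice_def)

text \<open>There is no rule for meets: joins with a fixed element respect limits but need not
  distribute over meets. Closure under meets is obtained separately.\<close>

inductive_set limit_hull :: "('a, 'c) gorder_scheme \<Rightarrow> 'a set \<Rightarrow> 'a set"
  for L :: "('a, 'c) gorder_scheme" and F :: "'a set" where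
  base: "x \<in> F \<Longrightarrow> x \<in> limit_hull L F"
| limit: "stable_limit L s v \<Longrightarrow> (\<And>n. s n \<in> limit_hull L F) \<Longrightarrow> v \<in> limit_hull L F"
| up: "x \<in> limit_hull L F \<Longrightarrow> x \<sqsubseteq>\<^bsub>L\<^esub> y \<Longrightarrow> y \<in> carrier L \<Longrightarrow> y \<in> limit_hull L F"

context lattice
begin

lemma join_mono_le:
  assumes "x \<sqsubseteq> y" "a \<in> carrier L" "x \<in> carrier L" "y \<in> carrier L"
  shows "a \<squnion> x \<sqsubseteq> a \<squnion> y"
  by (rule join_le) (use assms join_left[of a y] join_right[of a y] in \<open>auto intro: le_trans\<close>)

lemma meet_mono_le:
  assumes "x \<sqsubseteq> y" "a \<in> carrier L" "x \<in> carrier L" "y \<in> carrier L"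
  shows "a \<sqinter> x \<sqsubseteq> a \<sqinter> y"
  by (rule meet_le) (use assms meet_left[of a x] meet_right[of a x] in \<open>auto intro: le_trans\<close>)

lemma meet_assoc:
  "x \<in> carrier L \<Longrightarrow> y \<in> carrier L \<Longrightarrow> z \<in> carrier L \<Longrightarrow> (x \<sqinter> y) \<sqinter> z = x \<sqinter> (y \<sqinter> z)"
  using weak_meet_assoc by (simp add: eq_is_equal)

lemma meet_interchange:
  assumes "a \<in> carrier L" "b \<in> carrier L" "c \<in> carrier L" "d \<in> carrier L"
  shows "(a \<sqinter> b) \<sqinter> (c \<sqinter> d) = (a \<sqinter> c) \<sqinter> (b \<sqinter> d)"
proof -
  have "b \<sqinter> (c \<sqinter> d) = c \<sqinter> (b \<sqinter> d)"
    using assms meet_assoc[of b c d] meet_assoc[of c b d] meet_comm[of L b c] by simp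
  thus ?thesis using assms by (simp add: meet_assoc)
qed

lemma join_idem: "x \<in> carrier L \<Longrightarrow> x \<squnion> x = x"
  using le_iff_meet[of x x] by simp

lemma closed_filtersD:
  assumes "F \<in> closed_filters L"
  shows "F \<subseteq> carrier L"
    and "x \<in> F \<Longrightarrow> x \<sqsubseteq> y \<Longrightarrow> y \<in> carrier L \<Longrightarrow> y \<in> F"
    and "x \<in> F \<Longrightarrow> y \<in> F \<Longrightarrow> x \<sqinter> y \<in> F"
    and "stable_limit L s v \<Longrightarrow> (\<And>n. s n \<in> F) \<Longrightarrow> v \<in> F"
  using assms unfolding closed_filters_def by blast+

lemma closed_filters_join:
  assumes "F \<in> closed_filters L" "x \<in> F" "y \<in> carrier L"
  shows "x \<squnion> y \<in> F" "y \<squnion> x \<in> F"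
proof -
  have x: "x \<in> carrier L" using assms closed_filtersD(1) by blast
  show "x \<squnion> y \<in> F" "y \<squnion> x \<in> F"
    by (rule closed_filtersD(2)[OF assms(1,2)]; use x assms(3) in \<open>simp add: join_left join_right\<close>)+
qed

lemma closed_filtersI:
  assumes "F \<subseteq> carrier L"
    and "\<And>x y. x \<in> F \<Longrightarrow> x \<sqsubseteq> y \<Longrightarrow> y \<in> carrier L \<Longrightarrow> y \<in> F"
    and "\<And>x y. x \<in> F \<Longrightarrow> y \<in> F \<Longrightarrow> x \<sqinter> y \<in> F"
    and "\<And>s v. stable_limit L s v \<Longrightarrow> (\<And>n. s n \<in> F) \<Longrightarrow> v \<in> F"
  shows "F \<in> closed_filters L"
  unfolding closed_filters_def using assms by blast

text \<open>Intersecting with the carrier gives the right value for the empty family.\<close>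

lemma Inter_closed_filters:
  assumes "A \<subseteq> closed_filters L"
  shows "carrier L \<inter> \<Inter>A \<in> closed_filters L"
proof (rule closed_filtersI)
  have A: "F \<in> closed_filters L" if "F \<in> A" for F using assms that by blast
  fix x y
  show "y \<in> carrier L \<inter> \<Inter>A" if "x \<in> carrier L \<inter> \<Inter>A" "x \<sqsubseteq> y" "y \<in> carrier L"
    using that closed_filtersD(2)[OF A] by blast
  show "x \<sqinter> y \<in> carrier L \<inter> \<Inter>A" if "x \<in> carrier L \<inter> \<Inter>A" "y \<in> carrier L \<inter> \<Inter>A"
    using that closed_filtersD(3)[OF A] meet_closed by blast
  fix s v
  assume sv: "stable_limit L s v" "\<And>n. s n \<in> carrier L \<inter> \<Inter>A"
  have "v \<in> F" if "F \<in> A" for F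
    by (rule closed_filtersD(4)[OF A[OF that] sv(1)]) (use sv(2) that in blast)
  thus "v \<in> carrier L \<inter> \<Inter>A" using stable_limit_closed(2)[OF lattice_axioms sv(1)] by blast
qed blast

lemma Int_closed_filters:
  "F \<in> closed_filters L \<Longrightarrow> G \<in> closed_filters L \<Longrightarrow> F \<inter> G \<in> closed_filters L"
  using Inter_closed_filters[of "{F, G}"] closed_filtersD(1)[of F] by (simp add: Int_absorb1 le_infI1)

lemma limit_hull_closed:
  assumes "F \<subseteq> carrier L"
  shows "limit_hull L F \<subseteq> carrier L"
proof
  show "x \<in> carrier L" if "x \<in> limit_hull L F" for x
    using that by induction (use assms stable_limit_closed[OF lattice_axioms] in auto)
qed

text \<open>Meets with a fixed element respect limits. Induct on one argument with the other fixed
  in \<open>F\<close>, then exchange the roles.\<close>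

lemma limit_hull_meet:
  assumes F: "F \<subseteq> carrier L" "\<And>x y. x \<in> F \<Longrightarrow> y \<in> F \<Longrightarrow> x \<sqinter> y \<in> limit_hull L F"
    and "x \<in> limit_hull L F" "y \<in> limit_hull L F"
  shows "x \<sqinter> y \<in> limit_hull L F"
proof -
  note cl = limit_hull_closed[OF F(1)]
  have step: "a \<sqinter> y \<in> limit_hull L F"
    if a: "a \<in> carrier L" "\<And>x. x \<in> F \<Longrightarrow> a \<sqinter> x \<in> limit_hull L F" and "y \<in> limit_hull L F" for a y
    using that(3)
  proof induction
    case (limit s v)
    show ?case
      by (rule limit_hull.limit[OF stable_limit_join_meet(2)[OF limit.hyps(1) a(1)] limit.IH])
  next
    case (up x y)
    moreover have "a \<sqinter> x \<sqsubseteq> a \<sqinter> y" using up a cl by (blast intro: meet_mono_le)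
    ultimately show ?case using a by (blast intro: limit_hull.up meet_closed)
  qed (use a in auto)
  have "z \<sqinter> y \<in> limit_hull L F" if "z \<in> F" for z
    using step[of z y] F assms(4) that by blast
  hence "y \<sqinter> z \<in> limit_hull L F" if "z \<in> F" for z
    using that meet_comm by metis
  thus ?thesis using step[of y x] assms(3,4) cl by (simp add: subset_iff meet_comm)
qed

lemma limit_hull_closed_filter:
  assumes "F \<subseteq> carrier L" "\<And>x y. x \<in> F \<Longrightarrow> y \<in> F \<Longrightarrow> x \<sqinter> y \<in> limit_hull L F"
  shows "limit_hull L F \<in> closed_filters L"
  by (rule closed_filtersI)
    (use limit_hull_closed[OF assms(1)] limit_hull_meet[OF assms] in
      \<open>blast intro: limit_hull.limit limit_hull.up\<close>)+

text \<open>Used with \<open>y = a\<close>: idempotence then puts \<open>a\<close> itself into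
  \<open>B\<close>.\<close>

lemma limit_hull_join:
  assumes "B \<in> closed_filters L" "F \<subseteq> carrier L" "a \<in> carrier L"
    and "\<And>x. x \<in> F \<Longrightarrow> a \<squnion> x \<in> B" and "y \<in> limit_hull L F"
  shows "a \<squnion> y \<in> B"
  using assms(5)
proof induction
  case (limit s v)
  show ?case
    by (rule closed_filtersD(4)[OF assms(1) stable_limit_join_meet(1)[OF limit.hyps(1) assms(3)]
          limit.IH])
next
  case (up x y)
  have "a \<squnion> x \<sqsubseteq> a \<squnion> y"
    by (rule join_mono_le) (use up.hyps assms(3) limit_hull_closed[OF assms(2)] in auto)
  thus ?case
    by (rule closed_filtersD(2)[OF assms(1) up.IH]) (use up.hyps(3) assms(3) in simp)
qed (use assms(4) in auto)

section \<open>Completeness and lower continuity\<close>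

lemma partial_order_closed_filter_lattice: "partial_order (closed_filter_lattice L)"
  by unfold_locales auto

lemma is_lub_closed_filter_lattice:
  assumes "A \<subseteq> closed_filters L"
  shows "is_lub (closed_filter_lattice L) (carrier L \<inter> \<Inter>A) A"
  using Inter_closed_filters[OF assms] assms
  by (auto simp: least_def Upper_def dest: closed_filtersD(1))

lemma complete_lattice_closed_filter_lattice: "complete_lattice (closed_filter_lattice L)"
proof -
  interpret M: partial_order "closed_filter_lattice L"
    by (rule partial_order_closed_filter_lattice)
  let ?M = "closed_filter_lattice L"
  have "\<exists>i. is_glb ?M i A" if A: "A \<subseteq> carrier ?M" for A
  proof -
    \<comment> \<open>Under reverse inclusion the lower bounds are the closed filters containing
      every member of \<open>A\<close>; their intersection is the least of these.\<close>
    let ?i = "carrier L \<inter> \<Inter>(Lower ?M A)"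
    have lower: "Lower ?M A \<subseteq> closed_filters L" by (auto simp: Lower_def)
    have "is_glb ?M ?i A"
      using Inter_closed_filters[OF lower] A
      by (auto simp: greatest_def Lower_def dest: closed_filtersD(1))
    thus ?thesis ..
  qed
  thus ?thesis using is_lub_closed_filter_lattice by unfold_locales auto
qed

lemma lattice_closed_filter_lattice: "lattice (closed_filter_lattice L)"
proof -
  interpret M: complete_lattice "closed_filter_lattice L"
    by (rule complete_lattice_closed_filter_lattice)
  show ?thesis by unfold_locales
qed

lemma join_closed_filter_lattice:
  assumes "F \<in> closed_filters L" "G \<in> closed_filters L"
  shows "F \<squnion>\<^bsub>closed_filter_lattice L\<^esub> G = F \<inter> G"
proof -
  interpret M: lattice "closed_filter_lattice L" by (rule lattice_closed_filter_lattice)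
  have "F \<inter> G = carrier L \<inter> \<Inter>{F, G}"
    using closed_filtersD(1)[OF assms(1)] by auto
  hence "is_lub (closed_filter_lattice L) (F \<inter> G) {F, G}"
    using is_lub_closed_filter_lattice[of "{F, G}"] assms by simp
  thus ?thesis
    using M.joinI[where P = "\<lambda>l. l = F \<inter> G" and x = F and y = G] M.least_unique assms by auto
qed

text \<open>Under inclusion \<open>D\<close> is directed upwards, so its union is closed under meets
  and \<open>m\<close> lies in the limit hull of the union. For \<open>u\<close> in
  \<open>A \<inter> m\<close>, joins of \<open>u\<close> with elements of the union lie in
  \<open>B\<close>, which extends to the hull and so to \<open>u \<squnion> u\<close>.\<close>

lemma lower_continuous_closed_filter_lattice: "lower_continuous (closed_filter_lattice L)"
  unfolding lower_continuous_def
proof (intro conjI ballI allI impI)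
  let ?M = "closed_filter_lattice L"
  fix A D m
  assume "A \<in> carrier ?M" "downward_directed ?M D" "is_glb ?M m D"
  hence A: "A \<in> closed_filters L" and D: "D \<subseteq> closed_filters L"
    and dir: "\<And>X Y. X \<in> D \<Longrightarrow> Y \<in> D \<Longrightarrow> \<exists>Z\<in>D. X \<subseteq> Z \<and> Y \<subseteq> Z"
    and m: "m \<in> closed_filters L" "\<And>X. X \<in> D \<Longrightarrow> X \<subseteq> m"
    and m_least: "\<And>B. B \<in> closed_filters L \<Longrightarrow> (\<And>X. X \<in> D \<Longrightarrow> X \<subseteq> B) \<Longrightarrow> m \<subseteq> B"
    by (auto simp: downward_directed_def greatest_def Lower_def)
  have UD: "\<Union>D \<subseteq> carrier L" using D closed_filtersD(1) by blast
  have "limit_hull L (\<Union>D) \<in> closed_filters L"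
  proof (rule limit_hull_closed_filter[OF UD])
    fix x y assume "x \<in> \<Union>D" "y \<in> \<Union>D"
    then obtain Z where "Z \<in> D" "x \<in> Z" "y \<in> Z" using dir by blast
    hence "x \<sqinter> y \<in> \<Union>D" using D closed_filtersD(3) by blast
    thus "x \<sqinter> y \<in> limit_hull L (\<Union>D)" by (rule limit_hull.base)
  qed
  hence m_hull: "m \<subseteq> limit_hull L (\<Union>D)"
    by (rule m_least) (auto intro: limit_hull.base)
  have join: "A \<squnion>\<^bsub>?M\<^esub> X = A \<inter> X" if "X \<in> closed_filters L" for X
    by (rule join_closed_filter_lattice[OF A that])
  have "A \<inter> m \<subseteq> B" if B: "B \<in> closed_filters L" "\<And>X. X \<in> D \<Longrightarrow> A \<inter> X \<subseteq> B" for B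
  proof
    fix u assume u: "u \<in> A \<inter> m"
    hence u_carrier: "u \<in> carrier L" using A closed_filtersD(1) by blast
    have "u \<squnion> x \<in> B" if x: "x \<in> \<Union>D" for x
    proof -
      obtain X where X: "X \<in> D" "x \<in> X" using x by blast
      hence "u \<squnion> x \<in> A \<inter> X"
        using u u_carrier UD x A D closed_filters_join[of A u x] closed_filters_join[of X x u] by blast
      thus ?thesis using B(2)[OF X(1)] by blast
    qed
    hence "u \<squnion> u \<in> B"
      using limit_hull_join[OF B(1) UD u_carrier] u m_hull by blast
    thus "u \<in> B" by (simp add: join_idem u_carrier)
  qed
  hence "is_glb ?M (A \<inter> m) ((\<lambda>X. A \<inter> X) ` D)"
    unfolding greatest_def Lower_def
    using Int_closed_filters[OF A] m D by (intro conjI ballI) (auto, blast+)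
  moreover have "(\<lambda>X. A \<squnion>\<^bsub>?M\<^esub> X) ` D = (\<lambda>X. A \<inter> X) ` D"
    using D join by (auto intro!: image_cong)
  ultimately show "is_glb ?M (A \<squnion>\<^bsub>?M\<^esub> m) ((\<lambda>X. A \<squnion>\<^bsub>?M\<^esub> X) ` D)"
    by (simp add: join m(1))
qed (rule lattice_closed_filter_lattice)

section \<open>Join-semidistributivity\<close>

text \<open>Joining \<open>w\<close> with an element of \<open>G\<close> or \<open>H\<close> lands
  in \<open>F \<inter> G\<close>, which is also \<open>F \<inter> H\<close>. So one sequence stays
  in \<open>G\<close> while the other stays in \<open>H\<close>.\<close>

lemma join_sd_seq_mem:
  assumes F: "F \<in> closed_filters L" and G: "G \<in> closed_filters L" and H: "H \<in> closed_filters L"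
    and eq: "F \<inter> G = F \<inter> H" and w: "w \<in> F" and "y \<in> G" "z \<in> H"
  shows "w \<squnion> sd_seq L w n y z \<in> F \<inter> G"
proof -
  have carr: "F \<subseteq> carrier L" "G \<subseteq> carrier L" "H \<subseteq> carrier L"
    using closed_filtersD(1) F G H by auto
  have join: "w \<squnion> x \<in> F \<inter> G" "w \<squnion> x \<in> F \<inter> H" if "x \<in> G \<or> x \<in> H" for x
    using closed_filters_join F G H w that carr eq by (metis IntI subsetD)+
  have "sd_seq L w n y z \<in> G \<and> sd_seq L w n z y \<in> H"
  proof (induction n)
    case (Suc n)
    thus ?case
      using join closed_filtersD(3)[OF G assms(6)] closed_filtersD(3)[OF H assms(7)] by simp
  qed (use assms in simp)
  thus ?thesis using join by blast
qed

lemma join_semidistributive_closed_filter_lattice: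
  "join_semidistributive (closed_filter_lattice L)"
proof -
  let ?M = "closed_filter_lattice L"
  interpret M: lattice ?M by (rule lattice_closed_filter_lattice)
  have "F \<inter> G = F \<inter> (G \<sqinter>\<^bsub>?M\<^esub> H)"
    if F: "F \<in> closed_filters L" and G: "G \<in> closed_filters L" and H: "H \<in> closed_filters L"
      and eq: "F \<inter> G = F \<inter> H" for F G H
  proof
    have carr: "F \<subseteq> carrier L" "G \<subseteq> carrier L" "H \<subseteq> carrier L"
      using closed_filtersD(1) F G H by auto
    show "F \<inter> G \<subseteq> F \<inter> (G \<sqinter>\<^bsub>?M\<^esub> H)"
      using M.meet_left[of G H] G H by auto
    have meet_le: "G \<sqinter>\<^bsub>?M\<^esub> H \<subseteq> B" if "B \<in> closed_filters L" "G \<subseteq> B" "H \<subseteq> B" for B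
      using M.meet_le[of B G H] that G H by simp
    \<comment> \<open>The limit hull of these meets is a closed filter; if \<open>G\<close> and
      \<open>H\<close> are nonempty it contains both, hence also their meet in the lattice of closed
      filters.\<close>
    define K where "K = {g \<sqinter> h |g h. g \<in> G \<and> h \<in> H}"
    have K: "K \<subseteq> carrier L" using carr by (auto simp: K_def intro!: meet_closed)
    have "limit_hull L K \<in> closed_filters L"
    proof (rule limit_hull_closed_filter[OF K])
      fix x y assume "x \<in> K" "y \<in> K"
      then obtain g h g' h' where x: "x = g \<sqinter> h" "g \<in> G" "h \<in> H"
        and y: "y = g' \<sqinter> h'" "g' \<in> G" "h' \<in> H"
        by (auto simp: K_def)
      hence "g \<in> carrier L" "h \<in> carrier L" "g' \<in> carrier L" "h' \<in> carrier L"
        using carr by auto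
      hence "x \<sqinter> y = (g \<sqinter> g') \<sqinter> (h \<sqinter> h')"
        unfolding x y by (simp add: meet_interchange)
      moreover have "g \<sqinter> g' \<in> G" "h \<sqinter> h' \<in> H"
        using closed_filtersD(3)[OF G] closed_filtersD(3)[OF H] x y by auto
      ultimately have "x \<sqinter> y \<in> K" unfolding K_def by blast
      thus "x \<sqinter> y \<in> limit_hull L K" by (rule limit_hull.base)
    qed
    moreover have "G \<subseteq> limit_hull L K" if ne: "H \<noteq> {}"
    proof
      fix g assume "g \<in> G"
      moreover obtain h where "h \<in> H" using ne by blast
      ultimately have "g \<sqinter> h \<in> K" "g \<sqinter> h \<sqsubseteq> g" "g \<in> carrier L"
        using carr by (auto simp: K_def intro: meet_left)
      thus "g \<in> limit_hull L K" by (rule limit_hull.up[OF limit_hull.base])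
    qed
    moreover have "H \<subseteq> limit_hull L K" if ne: "G \<noteq> {}"
    proof
      fix h assume "h \<in> H"
      moreover obtain g where "g \<in> G" using ne by blast
      ultimately have "g \<sqinter> h \<in> K" "g \<sqinter> h \<sqsubseteq> h" "h \<in> carrier L"
        using carr by (auto simp: K_def intro: meet_right)
      thus "h \<in> limit_hull L K" by (rule limit_hull.up[OF limit_hull.base])
    qed
    ultimately have hull: "G \<sqinter>\<^bsub>?M\<^esub> H \<subseteq> limit_hull L K" if "G \<noteq> {}" "H \<noteq> {}"
      using that by (intro meet_le) auto
    have "F \<inter> (G \<sqinter>\<^bsub>?M\<^esub> H) \<subseteq> F \<inter> G" if "G \<noteq> {}" "H \<noteq> {}"
    proof
      fix u assume u: "u \<in> F \<inter> (G \<sqinter>\<^bsub>?M\<^esub> H)"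
      hence u_carrier: "u \<in> carrier L" using carr by blast
      have "u \<squnion> x \<in> F \<inter> G" if x: "x \<in> K" for x
      proof -
        obtain g h where gh: "x = g \<sqinter> h" "g \<in> G" "h \<in> H" using x by (auto simp: K_def)
        \<comment> \<open>Since \<open>x\<close> is below \<open>w\<close>, the limit
          \<open>w \<squnion> x\<close> is below \<open>w\<close>, so \<open>w\<close> itself lies
          in \<open>F \<inter> G\<close>.\<close>
        define w where "w = u \<squnion> x"
        have w: "w \<in> F" "w \<in> carrier L"
          using closed_filters_join[OF F, of u x] u u_carrier x K by (auto simp: w_def)
        have "stable_limit L (\<lambda>n. w \<squnion> sd_seq L w n g h) (w \<squnion> x)"
          unfolding gh(1) using gh w carr by (intro stable_limit_sd_seq) auto
        hence "w \<squnion> x \<in> F \<inter> G"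
          by (rule closed_filtersD(4)[OF Int_closed_filters[OF F G]])
            (rule join_sd_seq_mem[OF F G H eq w(1) gh(2,3)])
        moreover have "w \<squnion> x \<sqsubseteq> w"
          using x K w u_carrier join_right[of u x] by (intro join_le) (auto simp: w_def)
        ultimately show ?thesis
          using closed_filtersD(2)[OF Int_closed_filters[OF F G]] w unfolding w_def by blast
      qed
      hence "u \<squnion> u \<in> F \<inter> G"
        using limit_hull_join[OF Int_closed_filters[OF F G] K u_carrier] u hull that by blast
      thus "u \<in> F \<inter> G" by (simp add: join_idem u_carrier)
    qed
    \<comment> \<open>If one filter is empty, the meet is contained in the other; \<open>eq\<close>
      covers the case of empty \<open>G\<close>.\<close>
    moreover have "F \<inter> (G \<sqinter>\<^bsub>?M\<^esub> H) \<subseteq> F \<inter> G" if "G = {} \<or> H = {}"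
      using meet_le[OF G] meet_le[OF H] that eq by blast
    ultimately show "F \<inter> (G \<sqinter>\<^bsub>?M\<^esub> H) \<subseteq> F \<inter> G" by blast
  qed
  thus ?thesis
    unfolding join_semidistributive_def
    using lattice_closed_filter_lattice join_closed_filter_lattice M.meet_closed by simp
qed

end

section \<open>The embedding by principal filters\<close>

lemma principal_filter_closed:
  assumes "lower_bounded_lattice L" "a \<in> carrier L"
  shows "principal_filter L a \<in> closed_filters L"
proof -
  interpret lattice L using assms by (simp add: lower_bounded_lattice_def)
  show ?thesis
  proof (rule closed_filtersI)
    fix s v
    assume "stable_limit L s v" "\<And>n. s n \<in> principal_filter L a"
    thus "v \<in> principal_filter L a"
      using stable_limit_closed(2)[OF lattice_axioms] stable_limit_greatest[OF assms(1) _ assms(2)]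
      by (simp add: principal_filter_def)
  next
    show "y \<in> principal_filter L a"
      if "x \<in> principal_filter L a" "x \<sqsubseteq>\<^bsub>L\<^esub> y" "y \<in> carrier L" for x y
      using that assms(2) le_trans[of a x y] by (simp add: principal_filter_def)
  qed (use assms(2) in \<open>auto simp: principal_filter_def intro: meet_le\<close>)
qed

lemma principal_filter_embedding:
  assumes "lower_bounded_lattice L"
  shows "principal_filter L \<in> lattice_embeddings L (closed_filter_lattice L)"
proof -
  let ?M = "closed_filter_lattice L"
  interpret lattice L using assms by (simp add: lower_bounded_lattice_def)
  interpret M: lattice ?M by (rule lattice_closed_filter_lattice)
  note closed = principal_filter_closed[OF assms]
  have self: "a \<in> principal_filter L a" if "a \<in> carrier L" for a
    using that by (simp add: principal_filter_def)
  have join: "principal_filter L (a \<squnion>\<^bsub>L\<^esub> b) = principal_filter L a \<inter> principal_filter L b"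
    if ab: "a \<in> carrier L" "b \<in> carrier L" for a b
  proof -
    have "a \<squnion>\<^bsub>L\<^esub> b \<sqsubseteq>\<^bsub>L\<^esub> x \<longleftrightarrow> a \<sqsubseteq>\<^bsub>L\<^esub> x \<and> b \<sqsubseteq>\<^bsub>L\<^esub> x" if x: "x \<in> carrier L" for x
      using le_trans[OF join_left, of a b x] le_trans[OF join_right, of a b x] join_le[of a x b]
        ab x by auto
    thus ?thesis by (auto simp: principal_filter_def)
  qed
  have meet: "principal_filter L (a \<sqinter>\<^bsub>L\<^esub> b) = principal_filter L a \<sqinter>\<^bsub>?M\<^esub> principal_filter L b"
    if ab: "a \<in> carrier L" "b \<in> carrier L" for a b
  proof
    let ?m = "principal_filter L a \<sqinter>\<^bsub>?M\<^esub> principal_filter L b"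
    have m: "?m \<in> closed_filters L" using M.meet_closed closed ab by simp
    have "a \<in> ?m" "b \<in> ?m"
      using M.meet_left[of "principal_filter L a" "principal_filter L b"]
        M.meet_right[of "principal_filter L a" "principal_filter L b"] closed ab self by auto
    \<comment> \<open>The meet of the two filters contains both generators, hence their meet in
      \<open>L\<close>.\<close>
    hence "a \<sqinter>\<^bsub>L\<^esub> b \<in> ?m" by (rule closed_filtersD(3)[OF m])
    thus "principal_filter L (a \<sqinter>\<^bsub>L\<^esub> b) \<subseteq> ?m"
      using closed_filtersD(2)[OF m] by (auto simp: principal_filter_def)
    have "principal_filter L a \<subseteq> principal_filter L (a \<sqinter>\<^bsub>L\<^esub> b)"
      "principal_filter L b \<subseteq> principal_filter L (a \<sqinter>\<^bsub>L\<^esub> b)"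
      using ab meet_left[of a b] meet_right[of a b]
      by (auto simp: principal_filter_def intro: le_trans)
    thus "?m \<subseteq> principal_filter L (a \<sqinter>\<^bsub>L\<^esub> b)"
      using M.meet_le[of "principal_filter L (a \<sqinter>\<^bsub>L\<^esub> b)" "principal_filter L a" "principal_filter L b"]
        closed ab by simp
  qed
  have "inj_on (principal_filter L) (carrier L)"
  proof (rule inj_onI)
    fix a b
    assume ab: "a \<in> carrier L" "b \<in> carrier L" "principal_filter L a = principal_filter L b"
    hence "b \<in> principal_filter L a" "a \<in> principal_filter L b" using self by blast+
    thus "a = b" using ab by (auto simp: principal_filter_def)
  qed
  thus ?thesis
    using closed join meet lattice_axioms lattice_closed_filter_lattice
    by (simp add: lattice_embeddings_def lattice_homs_def join_pres_def meet_pres_def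
        join_closed_filter_lattice Pi_iff)
qed

theorem corollary11p5:
  fixes L :: "('a, 'c) gorder_scheme"
  assumes "lower_bounded_lattice L"
  shows "\<exists>(M :: 'a set gorder) f.
    complete_lattice M \<and> lower_continuous M \<and> join_semidistributive M \<and>
    f \<in> lattice_embeddings L M"
proof -
  interpret lattice L using assms by (simp add: lower_bounded_lattice_def)
  show ?thesis
    using complete_lattice_closed_filter_lattice lower_continuous_closed_filter_lattice
      join_semidistributive_closed_filter_lattice principal_filter_embedding[OF assms]
    by blast
qed

end
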